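(* Let $\mu$ be a translation bounded measure on $\mathbb R^d$ (hence a tempered distribution). Then (i) $\mu$ is weakly almost periodic as a tempered distribution if and only if $\mu$ is a weakly almost periodic measure; (ii) $\mu$ is strongly almost periodic as a tempered distribution if and only if $\mu$ is a strongly almost periodic measure; (iii) $\mu$ is null weakly almost periodic as a tempered distribution if and only if $\mu$ is a null weakly almost periodic measure.
   Context: For a tempered distribution $\psi$ and $f\in\mathcal S(\mathbb R^d)$, $\psi*f(t)=\psi(T_tf_-)$ with $f_-(s)=f(-s)$, $T_tf(x)=f(x-t)$. A tempered distribution $\psi$ is weakly / strongly / null weakly almost periodic if $\psi*f\in WAP(\mathbb R^d)$ / $SAP(\mathbb R^d)$ / $WAP_0(\mathbb R^d)$ for all $f\in\mathcal S$. A measure $\mu$ is a weakly / strongly / null weakly almost periodic measure if $\mu*f\in WAP(\mathbb R^d)$ / $SAP(\mathbb R^d)$ / $WAP_0(\mathbb R^d)$ for all continuous compactly supported $f$. Here $WAP$, $SAP$, $WAP_0$ are the spaces of weakly almost periodic, Bohr almost periodic, and null weakly almost periodic functions. *)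

theory Defs
  imports "HOL-Analysis.Analysis"
begin

definition Cc :: "('a::euclidean_space \<Rightarrow> complex) set" where
  "Cc = {f. continuous_on UNIV f \<and> (\<exists>K. compact K \<and> (\<forall>x. x \<notin> K \<longrightarrow> f x = 0))}"

text \<open>Schwartz space: all iterated partial derivatives (along basis directions) exist
  everywhere and decay faster than any polynomial.  D vs is the iterated partial
  derivative along the directions in the list vs (D (v # vs) = partial_v (D vs)).\<close>
definition schwartz :: "('a::euclidean_space \<Rightarrow> complex) set" where
  "schwartz = {f. \<exists>D :: 'a list \<Rightarrow> 'a \<Rightarrow> complex.
      D [] = f \<and>
      (\<forall>vs x. set vs \<subseteq> Basis \<longrightarrow>
          (\<exists>L. (D vs has_derivative L) (at x) \<and> (\<forall>v\<in>Basis. L v = D (v # vs) x))) \<and>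
      (\<forall>vs (N::nat). set vs \<subseteq> Basis \<longrightarrow>
          (\<exists>C. \<forall>x. (1 + norm x) ^ N * norm (D vs x) \<le> C))}"

text \<open>A (complex Radon) measure mu on R^d is represented by its polar decomposition
  mu = h |mu|: nu = |mu| is a positive Borel measure and h is a Borel function with |h| = 1.
  Translation boundedness: sup_t |mu|(t + K) < infinity for every compact K.\<close>
definition translation_bounded_measure :: "'a::euclidean_space measure \<Rightarrow> ('a \<Rightarrow> complex) \<Rightarrow> bool" where
  "translation_bounded_measure \<nu> h \<longleftrightarrow>
     sets \<nu> = sets borel \<and> h \<in> borel_measurable borel \<and> (\<forall>x. norm (h x) = 1) \<and>
     (\<forall>K. compact K \<longrightarrow> (\<exists>C::real. \<forall>t. emeasure \<nu> ((\<lambda>x. t + x) ` K) \<le> ennreal C))"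

text \<open>Convolution (mu * f)(t) = integral of f(t - s) d mu(s)
  (= mu(T_t f_-) when mu is viewed as a tempered distribution).\<close>
definition conv :: "'a::euclidean_space measure \<Rightarrow> ('a \<Rightarrow> complex) \<Rightarrow> ('a \<Rightarrow> complex) \<Rightarrow> 'a \<Rightarrow> complex" where
  "conv \<nu> h f t = (\<integral>s. f (t - s) * h s \<partial>\<nu>)"

definition orbit_Cb :: "('a::euclidean_space \<Rightarrow> complex) \<Rightarrow> ('a \<Rightarrow>\<^sub>C complex) set" where
  "orbit_Cb f = range (\<lambda>t. Bcontfun (\<lambda>x. f (x - t)))"

text \<open>Weak topology sigma(X, X*) of a normed space X.  (The real-valued continuous
  real-linear functionals generate the same topology as the complex ones.)\<close>
definition weak_topology :: "'b::real_normed_vector topology" where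
  "weak_topology = topology_generated_by
     {blinfun_apply \<phi> -` U | (\<phi> :: 'b \<Rightarrow>\<^sub>L real) U. open U}"

definition SAP :: "('a::euclidean_space \<Rightarrow> complex) set" where
  "SAP = {f. f \<in> bcontfun \<and> compact (closure (orbit_Cb f))}"

definition WAP :: "('a::euclidean_space \<Rightarrow> complex) set" where
  "WAP = {f. f \<in> bcontfun \<and> compactin weak_topology (weak_topology closure_of (orbit_Cb f))}"

definition WAP0 :: "('a::euclidean_space \<Rightarrow> complex) set" where
  "WAP0 = {f. f \<in> WAP \<and>
     ((\<lambda>n::nat. integral (cbox (- (real n *\<^sub>R One)) (real n *\<^sub>R One)) (\<lambda>x. norm (f x))
                 / (2 * real n) ^ DIM('a)) \<longlonglongrightarrow> 0)}"

end

theory Submission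
  imports Defs
begin

text \<open>Translation boundedness makes \<open>f \<mapsto> \<mu> * f\<close> continuous from continuous functions with a
  sufficiently strong polynomial weight norm into the bounded functions with the sup norm. In such a
  weight norm the Schwartz functions and \<open>Cc\<close> can each be approximated by the other, and \<open>WAP\<close>,
  \<open>SAP\<close> and \<open>WAP0\<close> are closed under uniform limits, so testing on either class is the same.\<close>

section \<open>Weak compactness in the space of bounded continuous functions\<close>

text \<open>A measure with infinite total mass does not respect uniform closeness of test functions:
  the error must also decay. Polynomial decay suffices because a ball is covered by a fixed number
  of balls of half its radius, so ball measures grow at most polynomially in the radius.
  Approximating \<open>Cc\<close> needs Schwartz functions whose derivatives of all orders stay
  under control. They are written down explicitly as a Gaussian times a rational expression, a shape
  that differentiation preserves. The delicate closure property is that of \<open>WAP\<close>: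
  closeness in norm has to produce weak compactness. The orbit is moved into the product of real
  lines indexed by the functionals, where its closure is compact by Tychonoff; the real work is to
  show that every point of this closure is the evaluation at some bounded continuous
  function.\<close>

abbreviation weak_coords :: "'b::real_normed_vector \<Rightarrow> ('b \<Rightarrow>\<^sub>L real) \<Rightarrow> real" where
  "weak_coords x \<equiv> \<lambda>\<phi>. blinfun_apply \<phi> x"

lemma topspace_weak_topology [simp]: "topspace weak_topology = (UNIV :: 'a::real_normed_vector set)"
proof -
  have "UNIV = blinfun_apply (0 :: 'a \<Rightarrow>\<^sub>L real) -` UNIV" by simp
  then have "UNIV \<in> {blinfun_apply \<phi> -` U | (\<phi> :: 'a \<Rightarrow>\<^sub>L real) U. open U}"
    using open_UNIV by blast
  then show ?thesis
    unfolding weak_topology_def topology_generated_by_topspace by blast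
qed

lemma openin_weak_vimage: "open U \<Longrightarrow> openin weak_topology (blinfun_apply \<phi> -` U)" for \<phi> :: "'b::real_normed_vector \<Rightarrow>\<^sub>L real"
  unfolding weak_topology_def by (rule topology_generated_by_Basis) blast

lemma continuous_map_weak_coords:
  "continuous_map weak_topology euclidean (weak_coords :: 'b::real_normed_vector \<Rightarrow> _)"
proof -
  have "continuous_map weak_topology (product_topology (\<lambda>_. euclidean) UNIV) (weak_coords :: 'b \<Rightarrow> _)"
    unfolding continuous_map_componentwise_UNIV
    using openin_weak_vimage by (auto simp: continuous_map_def vimage_def)
  then show ?thesis by (simp add: euclidean_product_topology)
qed

text \<open>Subbasic weakly open sets are preimages of coordinate cylinders, and preimages commute
  with intersections and unions. With the continuity of \<open>weak_coords\<close>, the weak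
  topology is therefore the pullback of the product topology, so closures and compactness can be
  computed there.\<close>

lemma openin_weak_imp_vimage:
  assumes "openin weak_topology (U :: 'b::real_normed_vector set)"
  shows "\<exists>V. open V \<and> U = weak_coords -` V"
proof -
  have "generate_topology_on {blinfun_apply \<phi> -` U | (\<phi> :: 'b \<Rightarrow>\<^sub>L real) U. open U} U"
    using assms by (simp add: weak_topology_def openin_topology_generated_by_iff)
  then show ?thesis
  proof induction
    case Empty
    then show ?case by (intro exI[of _ "{}"]) auto
  next
    case (Int a b)
    then obtain V W where "open V" "open W" "a = weak_coords -` V" "b = weak_coords -` W" by blast
    then show ?case by (intro exI[of _ "V \<inter> W"]) auto
  next
    case (UN K)
    then obtain V where "\<And>k. k \<in> K \<Longrightarrow> open (V k) \<and> k = weak_coords -` V k" by metis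
    then show ?case by (intro exI[of _ "\<Union>(V ` K)"]) auto
  next
    case (Basis s)
    then obtain \<phi> :: "'b \<Rightarrow>\<^sub>L real" and U where s: "open U" "s = blinfun_apply \<phi> -` U" by auto
    have "open ((\<lambda>x. x \<phi>) -` U)"
      using s by (intro open_vimage continuous_on_product_coordinates) auto
    with s show ?case by (intro exI[of _ "(\<lambda>x. x \<phi>) -` U"]) auto
  qed
qed

lemma weak_closure_of_eq:
  "weak_topology closure_of A = weak_coords -` closure (weak_coords ` A)"
proof
  show "weak_topology closure_of A \<subseteq> weak_coords -` closure (weak_coords ` A)"
    using continuous_map_image_closure_subset[OF continuous_map_weak_coords, of A] by auto
next
  show "weak_coords -` closure (weak_coords ` A) \<subseteq> weak_topology closure_of A"
  proof
    fix x assume x: "x \<in> weak_coords -` closure (weak_coords ` A)"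
    show "x \<in> weak_topology closure_of A"
      unfolding in_closure_of
    proof safe
      fix T assume T: "x \<in> T" "openin weak_topology T"
      then obtain V where "open V" "T = weak_coords -` V" using openin_weak_imp_vimage by blast
      with x T have "V \<inter> weak_coords ` A \<noteq> {}"
        by (metis open_Int_closure_eq_empty disjoint_iff vimage_eq)
      with \<open>T = _\<close> show "\<exists>y. y \<in> A \<and> y \<in> T" by auto
    qed simp
  qed
qed

text \<open>A weakly open cover lifts to product-open sets, and these cover \<open>S\<close> because
  each of its points is some \<open>weak_coords x\<close>. Containment in the range is what has to
  be earned in the application.\<close>

lemma compactin_weak_vimage:
  assumes "compact S" "S \<subseteq> range weak_coords"
  shows "compactin weak_topology (weak_coords -` S)"
  unfolding compactin_def
proof safe
  fix \<U> :: "'a set set" assume U: "Ball \<U> (openin weak_topology)" "weak_coords -` S \<subseteq> \<Union>\<U>"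
  then obtain V where V: "\<And>u. u \<in> \<U> \<Longrightarrow> open (V u) \<and> u = weak_coords -` V u"
    by (metis openin_weak_imp_vimage)
  have "S \<subseteq> (\<Union>u\<in>\<U>. V u)"
  proof
    fix F assume "F \<in> S"
    then obtain x where x: "F = weak_coords x" using assms(2) by blast
    then obtain u where "u \<in> \<U>" "x \<in> u" using U(2) \<open>F \<in> S\<close> by auto
    then show "F \<in> (\<Union>u\<in>\<U>. V u)" using V x by blast
  qed
  then obtain \<F> where "\<F> \<subseteq> \<U>" "finite \<F>" "S \<subseteq> (\<Union>u\<in>\<F>. V u)"
    using compactE_image[OF assms(1), of \<U> V] V by metis
  then show "\<exists>\<F>. finite \<F> \<and> \<F> \<subseteq> \<U> \<and> weak_coords -` S \<subseteq> \<Union>\<F>"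
    using V by (intro exI[of _ \<F>]) fast
qed simp

lemma compact_imp_closed_fun:
  fixes S :: "('i \<Rightarrow> real) set"
  assumes "compact S" shows "closed S"
proof -
  have "Hausdorff_space (euclidean :: ('i \<Rightarrow> real) topology)"
    unfolding euclidean_product_topology[symmetric] by (simp add: Hausdorff_space_product_topology)
  then show ?thesis
    using assms by (metis closed_closedin compactin_imp_closedin compactin_euclidean_iff)
qed

text \<open>Tychonoff for closed intervals. With \<open>M \<phi>\<close> a multiple of
  \<open>norm \<phi>\<close> this box takes the place of a ball of the bidual in
  Banach-Alaoglu.\<close>

lemma compact_norm_box: "compact {F. \<forall>i::'i. \<bar>F i\<bar> \<le> (M i :: real)}"
proof -
  have "compactin (product_topology (\<lambda>i. euclidean) UNIV) (PiE UNIV (\<lambda>i. {- M i..M i}))"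
    by (subst compactin_PiE) auto
  also have "PiE UNIV (\<lambda>i. {- M i..M i}) = {F. \<forall>i::'i. \<bar>F i\<bar> \<le> M i}"
    by (auto simp: PiE_def Pi_def abs_le_iff minus_le_iff)
  finally show ?thesis by (simp add: euclidean_product_topology)
qed

text \<open>Real and imaginary parts of point evaluations are functionals of norm at most 1, and
  they serve as explicit norming functionals. The factor 2 comes from bounding the modulus by the
  sum of the absolute values of both parts.\<close>

lemma norming_bcontfun:
  fixes x :: "'a::metric_space \<Rightarrow>\<^sub>C complex"
  assumes "\<And>\<phi> :: ('a \<Rightarrow>\<^sub>C complex) \<Rightarrow>\<^sub>L real. \<bar>blinfun_apply \<phi> x\<bar> \<le> e * norm \<phi>" "0 \<le> e"
  shows "norm x \<le> 2 * e"
proof (rule norm_bound)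
  fix a
  have aux: "\<bar>T (apply_bcontfun x a)\<bar> \<le> e" if T: "bounded_linear T" "\<And>z. \<bar>T z\<bar> \<le> norm z" for T :: "complex \<Rightarrow> real"
  proof -
    interpret T: bounded_linear T by fact
    have bl: "bounded_linear (\<lambda>y :: 'a \<Rightarrow>\<^sub>C complex. T (apply_bcontfun y a))"
      by (rule bounded_linear_intro[where K = 1])
         (auto simp: T.add T.scaleR intro!: order.trans[OF T(2)] norm_bounded)
    have "norm (Blinfun (\<lambda>y :: 'a \<Rightarrow>\<^sub>C complex. T (apply_bcontfun y a))) \<le> 1"
      by (rule norm_blinfun_bound)
         (auto simp: bounded_linear_Blinfun_apply[OF bl] intro!: order.trans[OF T(2)] norm_bounded)
    then show ?thesis
      using \<open>0 \<le> e\<close> assms(1)[of "Blinfun (\<lambda>y. T (apply_bcontfun y a))"] bounded_linear_Blinfun_apply[OF bl]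
      by (smt (verit) mult_left_le)
  qed
  have "norm (apply_bcontfun x a) \<le> \<bar>Re (apply_bcontfun x a)\<bar> + \<bar>Im (apply_bcontfun x a)\<bar>"
    by (rule cmod_le)
  with aux[OF bounded_linear_Re abs_Re_le_cmod] aux[OF bounded_linear_Im abs_Im_le_cmod]
  show "norm (apply_bcontfun x a) \<le> 2 * e" by linarith
qed

text \<open>Grothendieck's lemma: the weak* closure of \<open>A\<close> in the bidual of the Banach space
  is within distance \<open>e\<close> of that space for every \<open>e > 0\<close>, hence contained in it.\<close>
lemma weakly_compact_closure_approx:
  fixes A :: "('a::metric_space \<Rightarrow>\<^sub>C complex) set"
  assumes "bounded A"
    and approx: "\<And>e. e > 0 \<Longrightarrow> \<exists>K. compactin weak_topology K \<and> (\<forall>x\<in>A. \<exists>y\<in>K. norm (x - y) \<le> e)"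
  shows "compactin weak_topology (weak_topology closure_of A)"
proof -
  let ?J = "weak_coords :: ('a \<Rightarrow>\<^sub>C complex) \<Rightarrow> _"
  obtain M where M: "\<And>x. x \<in> A \<Longrightarrow> norm x \<le> M" using assms(1) by (auto simp: bounded_iff)
  have "?J ` A \<subseteq> {F. \<forall>\<phi>. \<bar>F \<phi>\<bar> \<le> M * norm \<phi>}"
  proof clarsimp
    fix x \<phi> assume "x \<in> A"
    then show "\<bar>blinfun_apply \<phi> x\<bar> \<le> M * norm \<phi>"
      using norm_blinfun[of \<phi> x] M[of x] mult_right_mono[of "norm x" M "norm \<phi>"]
      by (simp add: mult.commute)
  qed
  then have "closure (?J ` A) \<subseteq> {F. \<forall>\<phi>. \<bar>F \<phi>\<bar> \<le> M * norm \<phi>}"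
    by (intro closure_minimal compact_imp_closed_fun compact_norm_box)
  moreover have "compact ({F. \<forall>\<phi>. \<bar>F \<phi>\<bar> \<le> M * norm \<phi>} \<inter> closure (?J ` A))"
    by (rule compact_Int_closed[OF compact_norm_box closed_closure])
  ultimately have comp: "compact (closure (?J ` A))" by (simp only: Int_absorb1)
  \<comment> \<open>\<open>?J\<close> A\<open>lies in the sum of the compact set\<close>?J
    \<open>K\<close> and a box of size \<open>e\<close>. This sum is a continuous image of a compact
    product, hence closed, so it still contains the limit point \<open>F\<close>.\<close>
  have near: "\<exists>x. \<forall>\<phi>. \<bar>F \<phi> - ?J x \<phi>\<bar> \<le> e * norm \<phi>" if F: "F \<in> closure (?J ` A)" and "e > 0" for F e
  proof -
    obtain K where K: "compactin weak_topology K" "\<And>x. x \<in> A \<Longrightarrow> \<exists>y\<in>K. norm (x - y) \<le> e"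
      using approx[OF \<open>e > 0\<close>] by blast
    have "compact (?J ` K)"
      using image_compactin[OF K(1) continuous_map_weak_coords] by simp
    moreover let ?B = "{F. \<forall>\<phi> :: ('a \<Rightarrow>\<^sub>C complex) \<Rightarrow>\<^sub>L real. \<bar>F \<phi>\<bar> \<le> e * norm \<phi>}"
    have "compact ?B" by (rule compact_norm_box)
    moreover let ?S = "(\<lambda>p \<phi>. fst p \<phi> + snd p \<phi>) ` (?J ` K \<times> ?B)"
    have "continuous_on (?J ` K \<times> ?B) (\<lambda>p \<phi>. fst p \<phi> + snd p \<phi>)"
      by (intro continuous_on_coordinatewise_then_product continuous_on_add
           continuous_on_product_then_coordinatewise[OF continuous_on_fst[OF continuous_on_id]]
           continuous_on_product_then_coordinatewise[OF continuous_on_snd[OF continuous_on_id]])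
    ultimately have "compact ?S"
      by (intro compact_continuous_image[of "?J ` K \<times> ?B"] compact_Times)
    then have "closed ?S" by (rule compact_imp_closed_fun)
    moreover have "?J ` A \<subseteq> ?S"
    proof
      fix G assume "G \<in> ?J ` A"
      then obtain x where x: "x \<in> A" "G = ?J x" by auto
      obtain y where y: "y \<in> K" "norm (x - y) \<le> e" using K(2)[OF x(1)] by blast
      have "\<bar>?J (x - y) \<phi>\<bar> \<le> e * norm \<phi>" for \<phi>
        using norm_blinfun[of \<phi> "x - y"] mult_right_mono[OF y(2), of "norm \<phi>"]
        by (simp add: mult.commute)
      then show "G \<in> ?S"
        using x y by (intro image_eqI[of _ _ "(?J y, ?J (x - y))"]) (auto simp: blinfun.diff_right)
    qed
    ultimately have "F \<in> ?S" using F closure_minimal by blast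
    then obtain y b where "F = (\<lambda>\<phi>. ?J y \<phi> + b \<phi>)" "\<forall>\<phi>. \<bar>b \<phi>\<bar> \<le> e * norm \<phi>" by auto
    then show ?thesis by (intro exI[of _ y]) simp
  qed
  have "closure (?J ` A) \<subseteq> range ?J"
  proof
    fix F assume F: "F \<in> closure (?J ` A)"
    have "\<forall>n. \<exists>x. \<forall>\<phi>. \<bar>F \<phi> - ?J x \<phi>\<bar> \<le> inverse (real (Suc n)) * norm \<phi>"
      using near[OF F] by simp
    then obtain x where x: "\<And>n \<phi>. \<bar>F \<phi> - ?J (x n) \<phi>\<bar> \<le> inverse (real (Suc n)) * norm \<phi>"
      by metis
    \<comment> \<open>Both \<open>x m\<close> and \<open>x n\<close> approximate the same
      \<open>F\<close> on every functional, so the norming lemma makes the sequence Cauchy.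
      Completeness then supplies the function whose evaluation is \<open>F\<close>.\<close>
    have d: "norm (x m - x n) \<le> 2 * (inverse (real (Suc m)) + inverse (real (Suc n)))" for m n
    proof (rule norming_bcontfun)
      fix \<phi>
      show "\<bar>blinfun_apply \<phi> (x m - x n)\<bar> \<le> (inverse (real (Suc m)) + inverse (real (Suc n))) * norm \<phi>"
        using x[of \<phi> m] x[of \<phi> n] by (simp add: blinfun.diff_right distrib_right)
    qed simp
    have "Cauchy x"
    proof (rule metric_CauchyI)
      fix e :: real assume "e > 0"
      then obtain N where N: "inverse (real (Suc N)) < e / 4"
        using reals_Archimedean[of "e / 4"] by auto
      show "\<exists>M. \<forall>m\<ge>M. \<forall>n\<ge>M. dist (x m) (x n) < e"
      proof (intro exI allI impI)
        fix m n assume "N \<le> m" "N \<le> n"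
        then have "inverse (real (Suc m)) \<le> inverse (real (Suc N))" "inverse (real (Suc n)) \<le> inverse (real (Suc N))"
          by (auto simp: field_simps)
        then have "2 * (inverse (real (Suc m)) + inverse (real (Suc n))) \<le> 2 * (inverse (real (Suc N)) + inverse (real (Suc N)))"
          by (intro mult_left_mono add_mono) simp_all
        also have "\<dots> < e" using N by simp
        finally show "dist (x m) (x n) < e" unfolding dist_norm using d by (rule le_less_trans[rotated])
      qed
    qed
    then obtain y where y: "x \<longlonglongrightarrow> y" by (metis Cauchy_convergent_iff convergent_def)
    have "F = ?J y"
    proof
      fix \<phi> :: "('a \<Rightarrow>\<^sub>C complex) \<Rightarrow>\<^sub>L real"
      have "(\<lambda>n. inverse (real (Suc n)) * norm \<phi>) \<longlonglongrightarrow> 0"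
        by (rule tendsto_mult_left_zero[OF LIMSEQ_inverse_real_of_nat])
      then have "(\<lambda>n. F \<phi> - ?J (x n) \<phi>) \<longlonglongrightarrow> 0"
        by (rule Lim_null_comparison[rotated]) (use x in \<open>auto intro!: always_eventually\<close>)
      moreover have "(\<lambda>n. F \<phi> - ?J (x n) \<phi>) \<longlonglongrightarrow> F \<phi> - ?J y \<phi>"
        by (intro tendsto_intros y)
      ultimately show "F \<phi> = ?J y \<phi>"
        by (metis LIMSEQ_unique right_minus_eq)
    qed
    then show "F \<in> range ?J" by blast
  qed
  with comp show ?thesis
    unfolding weak_closure_of_eq by (rule compactin_weak_vimage)
qed

section \<open>Uniform limits of almost periodic functions\<close>

text \<open>\<open>Bcontfun\<close> can be unfolded only on bounded continuous functions, so every
  computation with orbit elements passes through this fact.\<close>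

lemma translate_bcontfun:
  fixes u :: "'a::euclidean_space \<Rightarrow> complex"
  assumes "u \<in> bcontfun"
  shows "apply_bcontfun (Bcontfun (\<lambda>x. u (x - t))) = (\<lambda>x. u (x - t))"
proof (rule Bcontfun_inverse)
  have "continuous_on UNIV (\<lambda>x. u (x - t))"
    using assms continuous_on_compose2[of UNIV u UNIV "\<lambda>x. x - t"]
    by (simp add: bcontfun_def continuous_on_diff)
  moreover have "range (\<lambda>x. u (x - t)) \<subseteq> range u" by auto
  ultimately show "(\<lambda>x. u (x - t)) \<in> bcontfun"
    using assms by (auto simp: bcontfun_def intro: bounded_subset)
qed

lemma bcontfun_uniform_approx:
  fixes u :: "'a::euclidean_space \<Rightarrow> complex"
  assumes "\<And>e. e > 0 \<Longrightarrow> \<exists>v\<in>bcontfun. \<forall>x. norm (u x - v x) \<le> e"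
  shows "u \<in> bcontfun"
proof -
  have "\<forall>n. \<exists>v\<in>bcontfun. \<forall>x. norm (u x - v x) \<le> inverse (real (Suc n))"
    using assms by simp
  then obtain v where v: "\<And>n. v n \<in> bcontfun" "\<And>n x. norm (u x - v n x) \<le> inverse (real (Suc n))"
    by metis
  have "uniform_limit UNIV v u sequentially"
    unfolding uniform_limit_sequentially_iff
  proof (intro allI impI)
    fix e :: real assume "e > 0"
    then obtain N where N: "inverse (real (Suc N)) < e" using reals_Archimedean by blast
    have "dist (v n x) (u x) < e" if "n \<ge> N" for n x
    proof -
      have "inverse (real (Suc n)) \<le> inverse (real (Suc N))" using that by (simp add: field_simps)
      then show ?thesis using v(2)[of x n] N unfolding dist_norm norm_minus_commute[of "v n x"] by linarith
    qed
    then show "\<exists>N. \<forall>n\<ge>N. \<forall>x\<in>UNIV. dist (v n x) (u x) < e" by blast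
  qed
  then obtain l :: "'a \<Rightarrow>\<^sub>C complex" where "u = apply_bcontfun l"
    using v(1) uniform_limit_bcontfunE[of "\<lambda>n. Bcontfun (v n)" u sequentially]
    by (auto simp: Bcontfun_inverse)
  then show ?thesis using apply_bcontfun by simp
qed

text \<open>Translating both functions by the same \<open>t\<close> preserves their uniform
  distance.\<close>

lemma orbit_Cb_close:
  assumes "u \<in> bcontfun" "v \<in> bcontfun" "\<And>x. norm (u x - v x) \<le> e" "y \<in> orbit_Cb u"
  obtains z where "z \<in> orbit_Cb v" "norm (y - z) \<le> e"
proof -
  obtain t where y: "y = Bcontfun (\<lambda>x. u (x - t))" using assms(4) by (auto simp: orbit_Cb_def)
  have "norm (y - Bcontfun (\<lambda>x. v (x - t))) \<le> e"
    by (rule norm_bound) (simp add: y minus_bcontfun.rep_eq translate_bcontfun assms)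
  then show thesis by (intro that[of "Bcontfun (\<lambda>x. v (x - t))"]) (auto simp: orbit_Cb_def)
qed

lemma bounded_orbit_Cb:
  assumes "u \<in> bcontfun" shows "bounded (orbit_Cb u)"
proof -
  obtain B where "\<And>x. norm (u x) \<le> B" using assms by (auto simp: bcontfun_def bounded_iff)
  then have "norm y \<le> B" if "y \<in> orbit_Cb u" for y
    using that by (auto simp: orbit_Cb_def translate_bcontfun assms intro!: norm_bound)
  then show ?thesis by (auto simp: bounded_iff)
qed

lemma SAP_uniform_approx:
  fixes u :: "'a::euclidean_space \<Rightarrow> complex"
  assumes approx: "\<And>e. e > 0 \<Longrightarrow> \<exists>v\<in>SAP. \<forall>x. norm (u x - v x) \<le> e"
  shows "u \<in> SAP"
proof -
  have u: "u \<in> bcontfun"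
    by (rule bcontfun_uniform_approx) (use approx in \<open>force simp: SAP_def\<close>)
  have "\<exists>T. finite T \<and> closure (orbit_Cb u) \<subseteq> (\<Union>x\<in>T. ball x e)" if "e > 0" for e
  proof -
    obtain v where v: "v \<in> SAP" "\<And>x. norm (u x - v x) \<le> e / 4"
      using approx[of "e / 4"] \<open>e > 0\<close> by auto
    then obtain T where T: "finite T" "closure (orbit_Cb v) \<subseteq> (\<Union>x\<in>T. ball x (e / 4))"
      unfolding SAP_def compact_eq_totally_bounded using \<open>e > 0\<close>
      by (auto dest!: spec[of _ "e / 4"])
    \<comment> \<open>Two errors of \<open>e / 4\<close> add up to \<open>e / 2\<close>. Closed
      balls are used so that their finite union absorbs the closure; the room up to \<open>e\<close>
      then allows open balls.\<close>
    have "orbit_Cb u \<subseteq> (\<Union>x\<in>T. cball x (e / 2))"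
    proof
      fix y assume "y \<in> orbit_Cb u"
      then obtain z where z: "z \<in> orbit_Cb v" "norm (y - z) \<le> e / 4"
        using orbit_Cb_close[OF u _ v(2)] v(1) unfolding SAP_def by blast
      then obtain x where x: "x \<in> T" "dist x z < e / 4" using T(2) closure_subset by force
      have "dist x y \<le> dist x z + dist y z" by (rule dist_triangle2)
      then show "y \<in> (\<Union>x\<in>T. cball x (e / 2))" using x z by (force simp: dist_norm)
    qed
    then have "closure (orbit_Cb u) \<subseteq> (\<Union>x\<in>T. cball x (e / 2))"
      by (rule closure_minimal) (use T(1) in auto)
    also have "\<dots> \<subseteq> (\<Union>x\<in>T. ball x e)" using \<open>e > 0\<close> by force
    finally show ?thesis using T(1) by blast
  qed
  then show ?thesis
    using u by (auto simp: SAP_def compact_eq_totally_bounded complete_eq_closed)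
qed

text \<open>Grothendieck's lemma applies with \<open>K\<close> the weak closure of the orbit of an
  approximant: it is weakly compact and comes within \<open>e\<close> in norm of every translate of
  \<open>u\<close>.\<close>

lemma WAP_uniform_approx:
  fixes u :: "'a::euclidean_space \<Rightarrow> complex"
  assumes approx: "\<And>e. e > 0 \<Longrightarrow> \<exists>v\<in>WAP. \<forall>x. norm (u x - v x) \<le> e"
  shows "u \<in> WAP"
proof -
  have u: "u \<in> bcontfun"
    by (rule bcontfun_uniform_approx) (use approx in \<open>force simp: WAP_def\<close>)
  have "compactin weak_topology (weak_topology closure_of (orbit_Cb u))"
  proof (rule weakly_compact_closure_approx[OF bounded_orbit_Cb[OF u]])
    fix e :: real assume "e > 0"
    then obtain v where v: "v \<in> WAP" "\<And>x. norm (u x - v x) \<le> e" using approx by blast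
    let ?K = "weak_topology closure_of (orbit_Cb v)"
    have "\<exists>z\<in>?K. norm (y - z) \<le> e" if "y \<in> orbit_Cb u" for y
      using orbit_Cb_close[OF u _ v(2) that] v(1) closure_of_subset[of "orbit_Cb v" weak_topology]
      unfolding WAP_def by auto
    then show "\<exists>K. compactin weak_topology K \<and> (\<forall>x\<in>orbit_Cb u. \<exists>y\<in>K. norm (x - y) \<le> e)"
      using v(1) by (auto simp: WAP_def)
  qed
  with u show ?thesis by (simp add: WAP_def)
qed

lemma content_symmetric_cube:
  "measure lborel (cbox (- (real n *\<^sub>R One)) (real n *\<^sub>R One :: 'a::euclidean_space)) = (2 * real n) ^ DIM('a)"
proof -
  have One: "(One :: 'a) \<bullet> i = 1" if "i \<in> Basis" for i
    using that by simp
  have "measure lborel (cbox (- (real n *\<^sub>R One)) (real n *\<^sub>R One :: 'a)) = (\<Prod>i\<in>(Basis :: 'a set). 2 * real n)"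
    by (subst content_cbox) (simp_all only: One inner_minus_left inner_scaleR_left, auto intro!: prod.cong)
  then show ?thesis by (simp only: prod_constant)
qed

text \<open>The mean is monotone, and since the denominator is the volume of the cube, the mean of
  the constant \<open>e / 2\<close> is \<open>e / 2\<close>.\<close>

lemma WAP0_uniform_approx:
  fixes u :: "'a::euclidean_space \<Rightarrow> complex"
  assumes approx: "\<And>e. e > 0 \<Longrightarrow> \<exists>v\<in>WAP0. \<forall>x. norm (u x - v x) \<le> e"
  shows "u \<in> WAP0"
proof -
  have "u \<in> WAP"
    by (rule WAP_uniform_approx) (drule approx, unfold WAP0_def, blast)
  define Q where "Q n = cbox (- (real n *\<^sub>R One)) (real n *\<^sub>R One :: 'a)" for n :: nat
  define m where "m v n = integral (Q n) (\<lambda>x. norm (v x)) / (2 * real n) ^ DIM('a)"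
    for v :: "'a \<Rightarrow> complex" and n :: nat
  have m_eq: "m v = (\<lambda>n. integral (cbox (- (real n *\<^sub>R One)) (real n *\<^sub>R One)) (\<lambda>x. norm (v x))
      / (2 * real n) ^ DIM('a))" for v
    by (rule ext) (simp only: m_def Q_def)
  have int: "(\<lambda>x. norm (v x)) integrable_on Q n" if "v \<in> WAP" for v n
    using that unfolding Q_def
    by (intro integrable_continuous continuous_intros) (auto simp: WAP_def bcontfun_def intro: continuous_on_subset)
  have "m u \<longlonglongrightarrow> 0"
  proof (rule LIMSEQ_I)
    fix e :: real assume "e > 0"
    then obtain v where v: "v \<in> WAP0" "\<And>x. norm (u x - v x) \<le> e / 2"
      using approx[of "e / 2"] by auto
    then have "m v \<longlonglongrightarrow> 0" by (simp only: WAP0_def mem_Collect_eq m_eq)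
    then obtain N where N: "\<And>n. n \<ge> N \<Longrightarrow> norm (m v n) < e / 2"
      using LIMSEQ_D[of "m v" 0 "e / 2"] \<open>e > 0\<close> by auto
    \<comment> \<open>Starting at \<open>Suc N\<close> excludes \<open>n = 0\<close>, where the cube
      has volume 0 and the quotient is 0 by convention.\<close>
    have "norm (m u n - 0) < e" if n: "n \<ge> Suc N" for n
    proof -
      have pos: "(2 * real n) ^ DIM('a) > 0" using n by simp
      have "integral (Q n) (\<lambda>x. norm (u x)) \<le> integral (Q n) (\<lambda>x. norm (v x) + e / 2)"
      proof (rule integral_le)
        show "norm (u x) \<le> norm (v x) + e / 2" for x
          using norm_triangle_ineq2[of "u x" "v x"] v(2)[of x] by linarith
        show "(\<lambda>x. norm (v x) + e / 2) integrable_on Q n"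
          using v(1) by (intro integrable_add int) (auto simp: WAP0_def Q_def)
      qed (rule int[OF \<open>u \<in> WAP\<close>])
      also have "\<dots> = integral (Q n) (\<lambda>x. norm (v x)) + integral (Q n) (\<lambda>x. e / 2)"
        using v(1) by (intro integral_add int) (auto simp: WAP0_def Q_def)
      also have "integral (Q n) (\<lambda>x. e / 2) = e / 2 * (2 * real n) ^ DIM('a)"
        unfolding Q_def integral_const content_symmetric_cube by simp
      finally have mean: "integral (Q n) (\<lambda>x. norm (u x)) \<le> integral (Q n) (\<lambda>x. norm (v x)) + e / 2 * (2 * real n) ^ DIM('a)" .
      have "a / c \<le> b / c + e / 2" if "a \<le> b + e / 2 * c" "c > 0" for a b c :: real
        using that by (simp add: field_simps)
      from this[OF mean pos] have "m u n \<le> m v n + e / 2"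
        unfolding m_def .
      moreover have "m u n \<ge> 0" unfolding m_def
        by (intro divide_nonneg_nonneg integral_nonneg int \<open>u \<in> WAP\<close>) auto
      ultimately show ?thesis using N[of n] n by auto
    qed
    then show "\<exists>N. \<forall>n\<ge>N. norm (m u n - 0) < e" by blast
  qed
  with \<open>u \<in> WAP\<close> show ?thesis by (simp only: WAP0_def mem_Collect_eq m_eq)
qed

section \<open>Convolution with translation bounded measures\<close>

lemma compact_cball_finite_cover:
  "\<exists>T. finite T \<and> T \<noteq> {} \<and> cball (0::'a::euclidean_space) 2 \<subseteq> (\<Union>x\<in>T. cball x 1)"
proof -
  obtain T :: "'a set" where "finite T" "cball 0 2 \<subseteq> (\<Union>x\<in>T. ball x 1)"
    using compact_cball[of "0::'a" 2] zero_less_one unfolding compact_eq_totally_bounded by blast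
  then show ?thesis
    \<comment> \<open>Inserting 0 keeps the cover nonempty, so that its cardinality can later be
      divided by.\<close>
    by (intro exI[of _ "insert 0 T"]) (use ball_subset_cball in blast)
qed

text \<open>Rescaling by \<open>r\<close> and shifting to \<open>t\<close> lets one cover
  \<open>T\<close> serve all centres and radii; its cardinality acts as a doubling constant.\<close>

lemma cball_double_cover:
  fixes t :: "'a::real_normed_vector"
  assumes "cball (0::'a) 2 \<subseteq> (\<Union>x\<in>T. cball x 1)" "r > 0"
  shows "cball t (2 * r) \<subseteq> (\<Union>x\<in>T. cball (t + r *\<^sub>R x) r)"
proof
  fix y assume "y \<in> cball t (2 * r)"
  then have "norm (y - t) \<le> 2 * r" by (simp add: dist_norm norm_minus_commute)
  then have "inverse r * norm (y - t) \<le> 2"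
    using \<open>r > 0\<close> by (simp add: field_simps)
  then have "inverse r *\<^sub>R (y - t) \<in> cball 0 2"
    using \<open>r > 0\<close> by (simp add: scaleR_diff_right[symmetric] del: scaleR_diff_right)
  then obtain x where x: "x \<in> T" "norm (x - inverse r *\<^sub>R (y - t)) \<le> 1"
    using assms(1) by (force simp: dist_norm)
  have "t + r *\<^sub>R x - y = r *\<^sub>R (x - inverse r *\<^sub>R (y - t))"
    using \<open>r > 0\<close> by (simp add: scaleR_diff_right)
  then have "norm (t + r *\<^sub>R x - y) = r * norm (x - inverse r *\<^sub>R (y - t))"
    using \<open>r > 0\<close> by simp
  also have "\<dots> \<le> r" using x(2) \<open>r > 0\<close> by (simp add: mult_left_le)
  finally show "y \<in> (\<Union>x\<in>T. cball (t + r *\<^sub>R x) r)"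
    using x(1) by (auto simp: dist_norm)
qed

text \<open>Covering the ball of radius 2 by \<open>q\<close> unit balls gives \<open>\<nu> (cball t (2 ^ n)) \<le> q ^ n * c\<close>.
  Any weight with \<open>2 ^ N \<ge> 2 * q\<close> is thus dominated by a geometric series over dyadic balls.\<close>
lemma translation_bounded_weight:
  fixes \<nu> :: "'a::euclidean_space measure"
  assumes "translation_bounded_measure \<nu> h"
  shows "\<exists>N C. C \<ge> 0 \<and> (\<forall>(g :: 'a \<Rightarrow> complex) e. (\<forall>x. (1 + norm x) ^ N * norm (g x) \<le> e) \<longrightarrow>
    (\<forall>t. (\<integral>\<^sup>+s. ennreal (norm (g (t - s))) \<partial>\<nu>) \<le> ennreal (C * e)))"
proof -
  have sets [measurable_cong]: "sets \<nu> = sets borel" using assms by (simp add: translation_bounded_measure_def)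
  obtain T :: "'a set" where T: "finite T" "T \<noteq> {}" "cball 0 2 \<subseteq> (\<Union>x\<in>T. cball x 1)"
    using compact_cball_finite_cover by blast
  define q where "q = card T"
  have q: "q \<ge> 1" using T by (simp add: q_def Suc_leI card_gt_0_iff)
  obtain c0 where "\<And>t. emeasure \<nu> ((\<lambda>x. t + x) ` cball 0 1) \<le> ennreal c0"
    using assms compact_cball[of "0::'a" 1] unfolding translation_bounded_measure_def by blast
  define c where "c = max c0 0"
  have c: "c \<ge> 0" "\<And>t. emeasure \<nu> (cball t 1) \<le> ennreal c"
  proof -
    show "c \<ge> 0" by (simp add: c_def)
    fix t
    have "emeasure \<nu> (cball t 1) \<le> ennreal c0"
      using \<open>emeasure \<nu> ((\<lambda>x. t + x) ` cball 0 1) \<le> ennreal c0\<close> cball_translation[of t 0 1] by simp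
    also have "\<dots> \<le> ennreal c" by (simp add: c_def ennreal_leI)
    finally show "emeasure \<nu> (cball t 1) \<le> ennreal c" .
  qed
  have M: "emeasure \<nu> (cball t (2 ^ n)) \<le> ennreal (real q ^ n * c)" for t n
  proof (induction n arbitrary: t)
    case 0
    then show ?case using c by simp
  next
    case (Suc n)
    have "emeasure \<nu> (cball t (2 ^ Suc n)) \<le> emeasure \<nu> (\<Union>x\<in>T. cball (t + 2 ^ n *\<^sub>R x) (2 ^ n))"
      using cball_double_cover[OF T(3), of "2 ^ n" t] T(1) sets
      by (intro emeasure_mono sets.finite_UN) auto
    also have "\<dots> \<le> (\<Sum>x\<in>T. emeasure \<nu> (cball (t + 2 ^ n *\<^sub>R x) (2 ^ n)))"
      by (rule emeasure_subadditive_finite[OF T(1)]) (auto simp: sets)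
    also have "\<dots> \<le> (\<Sum>x\<in>T. ennreal (real q ^ n * c))"
      by (intro sum_mono Suc.IH)
    also have "\<dots> = ennreal (real q ^ Suc n * c)"
      using c(1) by (subst sum_ennreal) (auto simp: q_def mult.assoc)
    finally show ?case .
  qed
  define N where "N = 2 * q"
  have N: "2 * real q \<le> 2 ^ N"
    unfolding N_def using of_nat_less_two_power[of "2 * q", where 'a = real] by simp
  \<comment> \<open>The geometric series below has first term \<open>e * (2 * real q) * c\<close>
    and ratio 1/2, hence sum \<open>4 * real q * c * e\<close>.\<close>
  define C where "C = 4 * real q * c"
  have C: "C \<ge> 0" using c by (simp add: C_def)
  have bound: "(\<integral>\<^sup>+s. ennreal (norm (g (t - s))) \<partial>\<nu>) \<le> ennreal (C * e)"
    if g: "\<And>x. (1 + norm x) ^ N * norm (g x) \<le> e" for g :: "'a \<Rightarrow> complex" and e t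
  proof -
    have e: "e \<ge> 0" using order.trans[OF _ g[of 0]] by simp
    \<comment> \<open>On the shell \<open>2 ^ (n - 1) < norm y \<le> 2 ^ n\<close> the weight is at
      least \<open>(2 * q) ^ (n - 1)\<close>. The extra factor \<open>2 * real q\<close> pays for
      the shift by one and also covers \<open>n = 0\<close>. Against ball measures of order
      \<open>q ^ n\<close> this leaves \<open>(1 / 2) ^ n\<close>.\<close>
    define a where "a n = e * (2 * real q) * (1 / (2 * real q)) ^ n" for n
    have a: "a n \<ge> 0" for n using e by (simp add: a_def)
    have pt: "ennreal (norm (g (t - s))) \<le> (\<Sum>n. ennreal (a n) * indicator (cball t (2 ^ n)) s)" for s
    proof -
      define y where "y = t - s"
      obtain k where "norm y < 2 ^ k" using real_arch_pow[of 2 "norm y"] by auto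
      then have ex: "norm y \<le> 2 ^ k" by simp
      define n where "n = (LEAST n. norm y \<le> 2 ^ n)"
      have n: "norm y \<le> 2 ^ n" unfolding n_def by (rule LeastI[of "\<lambda>n. norm y \<le> 2 ^ n", OF ex])
      have "norm (g y) \<le> a n"
      proof (cases n)
        case 0
        have "norm (g y) \<le> (1 + norm y) ^ N * norm (g y)"
          by (simp add: mult_le_cancel_right1 one_le_power)
        also have "\<dots> \<le> e" by (rule g)
        also have "\<dots> \<le> e * (2 * real q)" using e q by (simp add: mult_le_cancel_left1)
        finally show ?thesis using 0 by (simp add: a_def)
      next
        case (Suc m)
        then have m: "2 ^ m < norm y"
          using not_less_Least[of m "\<lambda>n. norm y \<le> 2 ^ n"] by (auto simp: n_def)
        have "(2 * real q) ^ m \<le> (2 ^ N) ^ m" using N by (intro power_mono) auto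
        also have "\<dots> = (2 ^ m) ^ N" by (simp add: power_mult[symmetric] mult.commute)
        also have "\<dots> \<le> (1 + norm y) ^ N" using m by (intro power_mono) auto
        finally have "(2 * real q) ^ m * norm (g y) \<le> (1 + norm y) ^ N * norm (g y)"
          by (rule mult_right_mono) simp
        also have "\<dots> \<le> e" by (rule g)
        finally show ?thesis using q Suc by (simp add: a_def power_one_over field_simps)
      qed
      then have "ennreal (norm (g (t - s))) \<le> ennreal (a n) * indicator (cball t (2 ^ n)) s"
        using n by (simp add: y_def dist_norm ennreal_leI)
      also have "\<dots> \<le> (\<Sum>n. ennreal (a n) * indicator (cball t (2 ^ n)) s)"
        using sum_le_suminf[of b "{n}" for b :: "nat \<Rightarrow> ennreal", simplified] .
      finally show ?thesis .
    qed
    have "(\<integral>\<^sup>+s. ennreal (norm (g (t - s))) \<partial>\<nu>)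
        \<le> (\<integral>\<^sup>+s. (\<Sum>n. ennreal (a n) * indicator (cball t (2 ^ n)) s) \<partial>\<nu>)"
      by (intro nn_integral_mono pt)
    also have "\<dots> = (\<Sum>n. ennreal (a n) * emeasure \<nu> (cball t (2 ^ n)))"
      by (subst nn_integral_suminf)
         (auto simp: sets nn_integral_cmult_indicator intro!: borel_measurable_times_ennreal borel_measurable_indicator)
    also have "\<dots> \<le> (\<Sum>n. ennreal (e * (2 * real q) * c * (1 / 2) ^ n))"
    proof (intro suminf_le summableI)
      fix n
      have "ennreal (a n) * emeasure \<nu> (cball t (2 ^ n)) \<le> ennreal (a n) * ennreal (real q ^ n * c)"
        by (intro mult_left_mono M) simp
      also have "\<dots> = ennreal (a n * (real q ^ n * c))"
        using a c by (simp add: ennreal_mult)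
      also have "a n * (real q ^ n * c) = e * (2 * real q) * c * (1 / 2) ^ n"
        using q by (simp add: a_def power_divide power_mult_distrib)
      finally show "ennreal (a n) * emeasure \<nu> (cball t (2 ^ n)) \<le> ennreal (e * (2 * real q) * c * (1 / 2) ^ n)" .
    qed
    also have "\<dots> = ennreal (e * (2 * real q) * c * 2)"
    proof (rule suminf_ennreal_eq)
      show "(\<lambda>n. e * (2 * real q) * c * (1 / 2) ^ n) sums (e * (2 * real q) * c * 2)"
        using sums_mult[OF geometric_sums[of "1/2::real"], of "e * (2 * real q) * c"] by simp
    qed (use e c in auto)
    also have "e * (2 * real q) * c * 2 = C * e" by (simp add: C_def)
    finally show ?thesis .
  qed
  show ?thesis
    by (intro exI[of _ N] exI[of _ C] conjI C allI impI bound) blast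
qed

text \<open>As \<open>h\<close> has modulus 1, only the size of \<open>g\<close> matters.
  Integrability is recorded with the bound because the integral of a non-integrable function is 0 by
  convention, which would break subtraction of convolutions.\<close>

lemma conv_weight_bound:
  fixes \<nu> :: "'a::euclidean_space measure"
  assumes tb: "translation_bounded_measure \<nu> h"
  shows "\<exists>N C. C \<ge> 0 \<and> (\<forall>(g :: 'a \<Rightarrow> complex) e. g \<in> borel_measurable borel \<longrightarrow>
    (\<forall>x. (1 + norm x) ^ N * norm (g x) \<le> e) \<longrightarrow>
    (\<forall>t. integrable \<nu> (\<lambda>s. g (t - s) * h s) \<and> norm (conv \<nu> h g t) \<le> C * e))"
proof -
  have sets [measurable_cong]: "sets \<nu> = sets borel" and [measurable]: "h \<in> borel_measurable borel"
    and h: "\<And>x. norm (h x) = 1"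
    using tb by (auto simp: translation_bounded_measure_def)
  obtain N :: nat and C :: real where C: "C \<ge> 0" and nn:
    "\<And>(g :: 'a \<Rightarrow> complex) e t. (\<forall>x. (1 + norm x) ^ N * norm (g x) \<le> e) \<Longrightarrow>
       (\<integral>\<^sup>+s. ennreal (norm (g (t - s))) \<partial>\<nu>) \<le> ennreal (C * e)"
    using translation_bounded_weight[OF tb] by metis
  have "integrable \<nu> (\<lambda>s. g (t - s) * h s) \<and> norm (conv \<nu> h g t) \<le> C * e"
    if [measurable]: "g \<in> borel_measurable borel" and g: "\<forall>x. (1 + norm x) ^ N * norm (g x) \<le> e" for g :: "'a \<Rightarrow> complex" and e t
  proof
    have e: "e \<ge> 0" using order.trans[OF _ g[rule_format, of 0]] by simp
    have bd: "(\<integral>\<^sup>+s. ennreal (norm (g (t - s) * h s)) \<partial>\<nu>) \<le> ennreal (C * e)"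
      using nn[OF g] by (simp add: norm_mult h)
    show I: "integrable \<nu> (\<lambda>s. g (t - s) * h s)"
      by (rule integrableI_bounded) (measurable, rule le_less_trans[OF bd], simp)
    have "ennreal (norm (conv \<nu> h g t)) \<le> ennreal (C * e)"
      unfolding conv_def by (rule order.trans[OF integral_norm_bound_ennreal[OF I] bd])
    then show "norm (conv \<nu> h g t) \<le> C * e"
      using C e by (simp add: ennreal_le_iff)
  qed
  with C show ?thesis by blast
qed

section \<open>Schwartz functions\<close>

text \<open>Choosing a derivative for each member of \<open>F\<close> and iterating along the list
  yields the family \<open>D\<close>. Arbitrary order of differentiation is thus handled by checking
  one step for a whole class.\<close>

lemma schwartz_coinduct:
  fixes f :: "'a::euclidean_space \<Rightarrow> complex"
  assumes "f \<in> F"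
    and "\<And>f. f \<in> F \<Longrightarrow> \<exists>f'. \<forall>x. (f has_derivative f' x) (at x) \<and> (\<forall>v\<in>Basis. (\<lambda>x. f' x v) \<in> F)"
    and decay: "\<And>f N. f \<in> F \<Longrightarrow> \<exists>C. \<forall>x. (1 + norm x) ^ N * norm (f x) \<le> C"
  shows "f \<in> schwartz"
proof -
  obtain d where d: "\<And>f x. f \<in> F \<Longrightarrow> (f has_derivative d f x) (at x)"
    "\<And>f v. f \<in> F \<Longrightarrow> v \<in> Basis \<Longrightarrow> (\<lambda>x. d f x v) \<in> F"
    using assms(2) by metis
  define D where "D vs = foldr (\<lambda>v g x. d g x v) vs f" for vs
  have D: "D [] = f" "D (v # vs) = (\<lambda>x. d (D vs) x v)" for v vs by (simp_all add: D_def)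
  have DF: "set vs \<subseteq> Basis \<Longrightarrow> D vs \<in> F" for vs
    by (induction vs) (auto simp: D assms(1) d(2))
  show ?thesis
    unfolding schwartz_def
    by (rule CollectI, rule exI[of _ D]) (use DF d(1) decay in \<open>auto simp: D\<close>)
qed

section \<open>Explicit Schwartz functions: Gaussians times tame functions\<close>

lemma weight_gaussian_bounded: "(1 + norm x) ^ N * exp (- (x \<bullet> x)) \<le> exp ((real N)\<^sup>2)"
  for x :: "'a::real_inner"
proof -
  have "(1 + norm x) ^ N \<le> exp (norm x) ^ N"
    by (intro power_mono) auto
  also have "\<dots> = exp (real N * norm x)" by (simp add: exp_of_nat_mult)
  finally have "(1 + norm x) ^ N * exp (- (x \<bullet> x)) \<le> exp (real N * norm x) * exp (- (x \<bullet> x))"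
    by (rule mult_right_mono) simp
  also have "\<dots> = exp (real N * norm x - (norm x)\<^sup>2)"
    by (simp add: exp_diff exp_minus divide_inverse power2_norm_eq_inner)
  also have "\<dots> \<le> exp ((real N)\<^sup>2)"
  proof -
    \<comment> \<open>Completing the square gives
      \<open>N * r \<le> N\<^sup>2 + r\<^sup>2 / 4\<close> for \<open>r = norm x\<close>, and the
      Gaussian exponent absorbs the quarter.\<close>
    have "0 \<le> (real N - norm x / 2)\<^sup>2" by simp
    moreover have "(real N - norm x / 2)\<^sup>2 = (real N)\<^sup>2 - real N * norm x + (norm x)\<^sup>2 / 4"
      by (simp add: power2_eq_square field_simps)
    ultimately have "real N * norm x - (norm x)\<^sup>2 \<le> (real N)\<^sup>2"
      using zero_le_power2[of "norm x"] by linarith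
    then show ?thesis by simp
  qed
  finally show ?thesis .
qed

text \<open>Polynomials in \<open>x\<close> and \<open>1 / (1 + x \<bullet> x)\<close>: closed under differentiation, and containing the
  polynomials in the coordinates of the one-point compactification.\<close>
inductive tame :: "('a::euclidean_space \<Rightarrow> real) \<Rightarrow> bool" where
  linear: "bounded_linear f \<Longrightarrow> tame f"
| const: "tame (\<lambda>x. c)"
| add: "tame f \<Longrightarrow> tame g \<Longrightarrow> tame (\<lambda>x. f x + g x)"
| mult: "tame f \<Longrightarrow> tame g \<Longrightarrow> tame (\<lambda>x. f x * g x)"
| inv: "tame (\<lambda>x. inverse (1 + x \<bullet> x))"

lemma one_plus_inner_pos: "1 + x \<bullet> x > (0::real)" for x :: "'a::real_inner"
  by (simp add: add_pos_nonneg)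

lemma tame_has_derivative:
  "tame f \<Longrightarrow> \<exists>f'. \<forall>x. (f has_derivative f' x) (at x) \<and> (\<forall>v. tame (\<lambda>x. f' x v))"
proof (induction rule: tame.induct)
  case (linear f)
  then show ?case
    by (intro exI[of _ "\<lambda>x. f"]) (auto intro: bounded_linear_imp_has_derivative tame.const)
next
  case (const c)
  then show ?case
    by (intro exI[of _ "\<lambda>x v. 0"]) (auto intro: tame.const)
next
  case (add f g)
  then obtain f' g' where "\<And>x. (f has_derivative f' x) (at x) \<and> (\<forall>v. tame (\<lambda>x. f' x v))"
    "\<And>x. (g has_derivative g' x) (at x) \<and> (\<forall>v. tame (\<lambda>x. g' x v))" by metis
  then show ?case
    by (intro exI[of _ "\<lambda>x v. f' x v + g' x v"]) (auto intro: tame.intros has_derivative_add)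
next
  case (mult f g)
  then obtain f' g' where "\<And>x. (f has_derivative f' x) (at x) \<and> (\<forall>v. tame (\<lambda>x. f' x v))"
    "\<And>x. (g has_derivative g' x) (at x) \<and> (\<forall>v. tame (\<lambda>x. g' x v))" by metis
  with mult.hyps show ?case
    by (intro exI[of _ "\<lambda>x v. f x * g' x v + f' x v * g x"])
       (auto intro!: tame.add tame.mult has_derivative_mult)
next
  case inv
  show ?case
  proof (intro exI[of _ "\<lambda>x v. - 2 * (x \<bullet> v) * (inverse (1 + x \<bullet> x) * inverse (1 + x \<bullet> x))"] allI conjI)
    fix x v :: 'a
    show "((\<lambda>x. inverse (1 + x \<bullet> x)) has_derivative
        (\<lambda>v. - 2 * (x \<bullet> v) * (inverse (1 + x \<bullet> x) * inverse (1 + x \<bullet> x)))) (at x)"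
      using one_plus_inner_pos[of x]
      by (auto intro!: derivative_eq_intros simp: inner_commute)
    show "tame (\<lambda>x. - 2 * (x \<bullet> v) * (inverse (1 + x \<bullet> x) * inverse (1 + x \<bullet> x)))"
      by (intro tame.intros bounded_linear_inner_left)
  qed
qed

lemma tame_growth: "tame f \<Longrightarrow> \<exists>C m. \<forall>x. \<bar>f x\<bar> \<le> C * (1 + norm x) ^ m"
proof (induction rule: tame.induct)
  case (linear f)
  then obtain K where "\<And>x. norm (f x) \<le> norm x * K" "K > 0" using bounded_linear.pos_bounded by blast
  then have "\<bar>f x\<bar> \<le> K * (1 + norm x) ^ 1" for x
    by (smt (verit) mult_left_mono mult.commute power_one_right real_norm_def)
  then show ?case by blast
next
  case (const c)
  show ?case by (intro exI[of _ "\<bar>c\<bar>"] exI[of _ 0]) simp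
next
  case (add f g)
  then obtain C m C' m' where *: "\<And>x. \<bar>f x\<bar> \<le> C * (1 + norm x) ^ m" "\<And>x. \<bar>g x\<bar> \<le> C' * (1 + norm x) ^ m'"
    by metis
  \<comment> \<open>The signs are read off at the origin, where the weight equals 1.\<close>
  have "0 \<le> C" "0 \<le> C'" using order.trans[OF abs_ge_zero *(1)[of 0]] order.trans[OF abs_ge_zero *(2)[of 0]] by auto
  have "\<bar>f x + g x\<bar> \<le> (C + C') * (1 + norm x) ^ (m + m')" for x
  proof -
    have "C * (1 + norm x) ^ m \<le> C * (1 + norm x) ^ (m + m')"
      "C' * (1 + norm x) ^ m' \<le> C' * (1 + norm x) ^ (m + m')"
      using \<open>0 \<le> C\<close> \<open>0 \<le> C'\<close> by (auto intro!: mult_left_mono power_increasing)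
    then show ?thesis using *[of x] by (simp add: distrib_right)
  qed
  then show ?case by blast
next
  case (mult f g)
  then obtain C m C' m' where *: "\<And>x. \<bar>f x\<bar> \<le> C * (1 + norm x) ^ m" "\<And>x. \<bar>g x\<bar> \<le> C' * (1 + norm x) ^ m'"
    by metis
  have "\<bar>f x * g x\<bar> \<le> (C * C') * (1 + norm x) ^ (m + m')" for x
    using mult_mono[OF *(1)[of x] *(2)[of x] order.trans[OF abs_ge_zero *(1)]] by (simp add: abs_mult power_add mult_ac)
  then show ?case by blast
next
  case inv
  have "\<bar>inverse (1 + x \<bullet> x)\<bar> \<le> 1 * (1 + norm x) ^ 0" for x :: 'a
    using one_plus_inner_pos[of x] by (simp add: field_simps)
  then show ?case by blast
qed

text \<open>The product rule turns the factor \<open>p\<close> into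
  \<open>p' - 2 * (x \<bullet> v) * p\<close>, which is tame again, while the Gaussian stays in
  front.\<close>

lemma gaussian_tame_has_derivative:
  assumes "tame p"
  shows "\<exists>q. (\<forall>x. ((\<lambda>x. exp (- (x \<bullet> x)) * p x) has_derivative (\<lambda>v. exp (- (x \<bullet> x)) * q v x)) (at x))
    \<and> (\<forall>v. tame (q v))"
proof -
  obtain p' where p': "\<And>x. (p has_derivative p' x) (at x)" "\<And>v. tame (\<lambda>x. p' x v)"
    using tame_has_derivative[OF assms] by metis
  show ?thesis
  proof (intro exI[of _ "\<lambda>v x. p' x v + - 2 * (x \<bullet> v) * p x"] allI conjI)
    show "((\<lambda>x. exp (- (x \<bullet> x)) * p x) has_derivative
        (\<lambda>v. exp (- (x \<bullet> x)) * (p' x v + - 2 * (x \<bullet> v) * p x))) (at x)" for x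
      by (rule has_derivative_eq_rhs, rule has_derivative_mult[OF _ p'(1)], rule has_derivative_exp,
          rule derivative_intros, rule has_derivative_inner, (rule has_derivative_ident)+)
         (auto simp: algebra_simps inner_commute)
    show "tame (\<lambda>x. p' x v + - 2 * (x \<bullet> v) * p x)" for v
      by (intro tame.intros bounded_linear_inner_left p'(2) assms)
  qed
qed

lemma gaussian_tame_schwartz:
  assumes "tame p" "tame q"
  shows "(\<lambda>x. complex_of_real (exp (- (x \<bullet> x)) * p x) + \<i> * complex_of_real (exp (- (x \<bullet> x)) * q x)) \<in> schwartz"
proof (rule schwartz_coinduct[where F = "{\<lambda>x. complex_of_real (exp (- (x \<bullet> x)) * p x) +
      \<i> * complex_of_real (exp (- (x \<bullet> x)) * q x) | p q. tame p \<and> tame q}"])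
  fix f :: "'a \<Rightarrow> complex" and N :: nat
  assume "f \<in> {\<lambda>x. complex_of_real (exp (- (x \<bullet> x)) * p x) +
      \<i> * complex_of_real (exp (- (x \<bullet> x)) * q x) | p q. tame p \<and> tame q}"
  then obtain p q where pq: "tame p" "tame q" and f: "f = (\<lambda>x. complex_of_real (exp (- (x \<bullet> x)) * p x) +
      \<i> * complex_of_real (exp (- (x \<bullet> x)) * q x))"
    by blast
  obtain p' q' where p': "\<And>x. ((\<lambda>x. exp (- (x \<bullet> x)) * p x) has_derivative (\<lambda>v. exp (- (x \<bullet> x)) * p' v x)) (at x)"
      "\<And>v. tame (p' v)"
    and q': "\<And>x. ((\<lambda>x. exp (- (x \<bullet> x)) * q x) has_derivative (\<lambda>v. exp (- (x \<bullet> x)) * q' v x)) (at x)"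
      "\<And>v. tame (q' v)"
    using gaussian_tame_has_derivative[OF pq(1)] gaussian_tame_has_derivative[OF pq(2)] by blast
  show "\<exists>f'. \<forall>x. (f has_derivative f' x) (at x) \<and> (\<forall>v\<in>Basis. (\<lambda>x. f' x v) \<in> {\<lambda>x. complex_of_real (exp (- (x \<bullet> x)) * p x) +
      \<i> * complex_of_real (exp (- (x \<bullet> x)) * q x) | p q. tame p \<and> tame q})"
  proof (intro exI[of _ "\<lambda>x v. complex_of_real (exp (- (x \<bullet> x)) * p' v x) +
      \<i> * complex_of_real (exp (- (x \<bullet> x)) * q' v x)"] allI conjI ballI)
    show "(f has_derivative (\<lambda>v. complex_of_real (exp (- (x \<bullet> x)) * p' v x) +
      \<i> * complex_of_real (exp (- (x \<bullet> x)) * q' v x))) (at x)" for x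
      unfolding f
      by (intro has_derivative_add has_derivative_mult_right has_derivative_of_real p'(1) q'(1))
  qed (use p'(2) q'(2) in blast)
  have growth: "\<exists>B. \<forall>x. (1 + norm x) ^ N * \<bar>exp (- (x \<bullet> x)) * r x\<bar> \<le> B" if r: "tame r" for r :: "'a \<Rightarrow> real"
  proof -
    obtain C m where C: "\<And>x. \<bar>r x\<bar> \<le> C * (1 + norm x) ^ m" using tame_growth[OF r] by blast
    have "C \<ge> 0" using order.trans[OF abs_ge_zero C[of 0]] by simp
    have "(1 + norm x) ^ N * \<bar>exp (- (x \<bullet> x)) * r x\<bar> \<le> C * exp ((real (N + m))\<^sup>2)" for x
    proof -
      have "(1 + norm x) ^ N * \<bar>exp (- (x \<bullet> x)) * r x\<bar> = ((1 + norm x) ^ N * exp (- (x \<bullet> x))) * \<bar>r x\<bar>"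
        by (simp add: abs_mult)
      also have "\<dots> \<le> ((1 + norm x) ^ N * exp (- (x \<bullet> x))) * (C * (1 + norm x) ^ m)"
        by (intro mult_left_mono C) auto
      also have "\<dots> = C * ((1 + norm x) ^ (N + m) * exp (- (x \<bullet> x)))"
        by (simp add: power_add mult_ac)
      also have "\<dots> \<le> C * exp ((real (N + m))\<^sup>2)"
        by (intro mult_left_mono weight_gaussian_bounded \<open>C \<ge> 0\<close>)
      finally show ?thesis .
    qed
    then show ?thesis by blast
  qed
  obtain A B where AB: "\<And>x. (1 + norm x) ^ N * \<bar>exp (- (x \<bullet> x)) * p x\<bar> \<le> A"
    "\<And>x. (1 + norm x) ^ N * \<bar>exp (- (x \<bullet> x)) * q x\<bar> \<le> B"
    using growth[OF pq(1)] growth[OF pq(2)] by metis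
  have "(1 + norm x) ^ N * norm (f x) \<le> A + B" for x
  proof -
    have "norm (f x) \<le> \<bar>exp (- (x \<bullet> x)) * p x\<bar> + \<bar>exp (- (x \<bullet> x)) * q x\<bar>"
      unfolding f by (rule order.trans[OF norm_triangle_ineq]) (simp only: norm_mult norm_of_real norm_ii mult_1_left order.refl)
    then have "(1 + norm x) ^ N * norm (f x) \<le> (1 + norm x) ^ N * (\<bar>exp (- (x \<bullet> x)) * p x\<bar> + \<bar>exp (- (x \<bullet> x)) * q x\<bar>)"
      by (rule mult_left_mono) simp
    also have "\<dots> \<le> A + B" using add_mono[OF AB] by (simp only: distrib_left)
    finally show ?thesis .
  qed
  then show "\<exists>C. \<forall>x. (1 + norm x) ^ N * norm (f x) \<le> C" by blast
qed (use assms in blast)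

section \<open>Weighted approximation of \<open>Cc\<close> by Schwartz functions\<close>

text \<open>A linear \<open>f\<close> splits as
  \<open>f (c *\<^sub>R x, c) = c * f (x, 0) + c * f (0, 1)\<close>, and
  \<open>c = inverse (1 + x \<bullet> x)\<close> is a tame generator; sums and products
  follow.\<close>

lemma tame_of_polynomial:
  fixes P :: "'a::euclidean_space \<times> real \<Rightarrow> real"
  assumes "real_polynomial_function P"
  shows "tame (\<lambda>x. P (inverse (1 + x \<bullet> x) *\<^sub>R x, inverse (1 + x \<bullet> x)))"
  using assms
proof (induction rule: real_polynomial_function.induct)
  case (linear f)
  interpret f: bounded_linear f by fact
  have "f (c *\<^sub>R x, c) = c * f (x, 0) + c * f (0, 1)" for x :: 'a and c
    using f.add[of "c *\<^sub>R (x, 0)" "c *\<^sub>R (0, 1)"] f.scaleR[of c "(x, 0)"] f.scaleR[of c "(0, 1)"] by simp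
  moreover have "bounded_linear (\<lambda>x. f (x, 0))"
    using linear bounded_linear_compose[OF linear] bounded_linear_Pair[OF bounded_linear_ident bounded_linear_zero] by blast
  ultimately show ?case
    by (simp only:) (intro tame.intros)
qed (auto intro: tame.intros)

text \<open>The map \<open>x \<mapsto> (u *\<^sub>R x, u)\<close> with \<open>u = 1 / (1 + x \<bullet> x)\<close> is inverse stereographic projection onto the
  sphere \<open>y \<bullet> y + s\<^sup>2 = s\<close> minus the origin, where Stone--Weierstrass applies.\<close>
lemma tame_uniform_approx:
  fixes F :: "'a::euclidean_space \<Rightarrow> real"
  assumes F: "continuous_on UNIV F" and K: "compact K" "\<And>x. x \<notin> K \<Longrightarrow> F x = 0" and "e > 0"
  obtains p where "tame p" "\<And>x. \<bar>F x - p x\<bar> < e"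
proof -
  define S where "S = {p :: 'a \<times> real. fst p \<bullet> fst p + (snd p)\<^sup>2 = snd p}"
  \<comment> \<open>\<open>F\<close> transported to the sphere: \<open>x\<close> is recovered from
    \<open>p\<close> as the quotient of its components, and the origin, where
    \<open>snd p = 0\<close>, is the point at infinity.\<close>
  define G where "G p = (if snd p = 0 then 0 else F (inverse (snd p) *\<^sub>R fst p))" for p :: "'a \<times> real"
  have S01: "0 \<le> snd p" "snd p \<le> 1" "(norm (fst p))\<^sup>2 = snd p - (snd p)\<^sup>2" if "p \<in> S" for p
  proof -
    have *: "(norm (fst p))\<^sup>2 + (snd p)\<^sup>2 = snd p" using that by (simp add: S_def power2_norm_eq_inner)
    then show "(norm (fst p))\<^sup>2 = snd p - (snd p)\<^sup>2" by simp
    have le: "(snd p)\<^sup>2 \<le> snd p" using * zero_le_power2[of "norm (fst p)"] by linarith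
    then show "0 \<le> snd p" by (rule order.trans[OF zero_le_power2])
    show "snd p \<le> 1"
    proof (rule ccontr)
      assume "\<not> snd p \<le> 1"
      then have "snd p * 1 < snd p * snd p" by (intro mult_strict_left_mono) auto
      with le show False by (simp add: power2_eq_square)
    qed
  qed
  obtain R where R: "\<And>x. x \<in> K \<Longrightarrow> norm x \<le> R" using compact_imp_bounded[OF K(1)] by (auto simp: bounded_iff)
  \<comment> \<open>On the sphere the recovered \<open>x\<close> has squared norm
    \<open>inverse (snd p) - 1\<close>, so \<open>snd p < \<delta>\<close> forces
    \<open>norm x > R\<close>, outside \<open>K\<close>. Hence \<open>G\<close> vanishes near the
    point at infinity, which gives its continuity there.\<close>
  define \<delta> where "\<delta> = inverse (1 + R\<^sup>2)"
  have \<delta>: "\<delta> > 0" by (simp add: \<delta>_def add_pos_nonneg)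
  have S: "compact S"
  proof -
    have "closed S" unfolding S_def by (intro closed_Collect_eq continuous_intros)
    moreover have "norm p \<le> 1" if "p \<in> S" for p
    proof -
      have "(norm p)\<^sup>2 = snd p" using S01(1,3)[OF that] by (simp add: norm_prod_def)
      then show ?thesis using S01(2)[OF that] by (simp add: power2_le_imp_le)
    qed
    ultimately show ?thesis unfolding compact_eq_bounded_closed bounded_iff by blast
  qed
  have G: "continuous_on S G"
  proof -
    have S_eq: "S = (S \<inter> {p. snd p < \<delta>}) \<union> (S \<inter> {p. 0 < snd p})" using S01(1) \<delta> by force
    have o: "open {p :: 'a \<times> real. snd p < \<delta>}" "open {p :: 'a \<times> real. 0 < snd p}"
      by (intro open_Collect_less continuous_intros)+
    have G0: "G p = 0" if p: "p \<in> S \<inter> {p. snd p < \<delta>}" for p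
    proof (cases "snd p = 0")
      case False
      then have s: "0 < snd p" "snd p < \<delta>" using S01(1)[of p] p by auto
      have "inverse (snd p) *\<^sub>R fst p \<notin> K"
      proof
        assume "inverse (snd p) *\<^sub>R fst p \<in> K"
        then have "(inverse (snd p) * norm (fst p))\<^sup>2 \<le> R\<^sup>2"
          using R s by (intro power_mono) force+
        moreover have "(inverse (snd p) * norm (fst p))\<^sup>2 = (inverse (snd p))\<^sup>2 * (snd p - (snd p)\<^sup>2)"
          using S01(3)[of p] p by (simp add: power_mult_distrib)
        moreover have "\<dots> = inverse (snd p) - 1"
          using s by (simp add: field_simps power2_eq_square)
        ultimately have "inverse (snd p) - 1 \<le> R\<^sup>2" by simp
        then have "\<delta> \<le> snd p"
          using s unfolding \<delta>_def by (simp add: field_simps add_pos_nonneg)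
        with s show False by simp
      qed
      with K(2) show ?thesis by (simp add: G_def)
    qed (simp add: G_def)
    have "continuous_on (S \<inter> {p. 0 < snd p}) (\<lambda>p. F (inverse (snd p) *\<^sub>R fst p))"
      by (rule continuous_on_compose2[OF F]) (auto intro!: continuous_intros)
    then have "continuous_on (S \<inter> {p. 0 < snd p}) G"
      by (rule continuous_on_eq) (auto simp: G_def)
    moreover have "continuous_on (S \<inter> {p. snd p < \<delta>}) G"
      by (rule continuous_on_eq[OF continuous_on_const[of _ 0]]) (simp add: G0)
    ultimately show ?thesis
      using continuous_on_Un_local_open[of "S \<inter> {p. snd p < \<delta>}" "S \<inter> {p. 0 < snd p}" G] o
      unfolding S_eq[symmetric] by (simp add: openin_open_Int)
  qed
  obtain P where P: "real_polynomial_function P" "\<And>p. p \<in> S \<Longrightarrow> \<bar>G p - P p\<bar> < e"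
    by (rule Stone_Weierstrass_real_polynomial_function[OF S G \<open>e > 0\<close>]) blast
  show thesis
  proof (rule that[OF tame_of_polynomial[OF P(1)]])
    fix x :: 'a
    let ?u = "inverse (1 + x \<bullet> x)"
    have u: "?u > 0" using one_plus_inner_pos[of x] by simp
    have "(?u *\<^sub>R x) \<bullet> (?u *\<^sub>R x) + ?u\<^sup>2 = ?u * (?u * (1 + x \<bullet> x))"
      unfolding inner_scaleR_left inner_scaleR_right power2_eq_square distrib_left by simp
    also have "\<dots> = ?u" using one_plus_inner_pos[of x] by simp
    finally have "(?u *\<^sub>R x, ?u) \<in> S" by (simp add: S_def)
    from P(2)[OF this] show "\<bar>F x - P (?u *\<^sub>R x, ?u)\<bar> < e"
      using u one_plus_inner_pos[of x] by (simp add: G_def)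
  qed
qed

text \<open>Compact support survives multiplication by \<open>exp (x \<bullet> x)\<close>. A merely
  uniform approximation of that product, multiplied back by the Gaussian, has an error with Gaussian
  decay.\<close>

lemma Cc_approx_by_schwartz:
  fixes f :: "'a::euclidean_space \<Rightarrow> complex"
  assumes "f \<in> Cc" "e > 0"
  obtains g where "g \<in> schwartz" "\<And>x. norm (f x - g x) \<le> e * exp (- (x \<bullet> x))"
proof -
  obtain K where f: "continuous_on UNIV f" "compact K" "\<And>x. x \<notin> K \<Longrightarrow> f x = 0"
    using assms(1) by (auto simp: Cc_def)
  obtain p where p: "tame p" "\<And>x. \<bar>exp (x \<bullet> x) * Re (f x) - p x\<bar> < e / 2"
    by (rule tame_uniform_approx[of "\<lambda>x. exp (x \<bullet> x) * Re (f x)" K "e / 2"])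
       (use f \<open>e > 0\<close> in \<open>auto intro!: continuous_intros\<close>)
  obtain q where q: "tame q" "\<And>x. \<bar>exp (x \<bullet> x) * Im (f x) - q x\<bar> < e / 2"
    by (rule tame_uniform_approx[of "\<lambda>x. exp (x \<bullet> x) * Im (f x)" K "e / 2"])
       (use f \<open>e > 0\<close> in \<open>auto intro!: continuous_intros\<close>)
  have aux: "\<bar>a - exp (- (x \<bullet> x)) * b\<bar> \<le> e / 2 * exp (- (x \<bullet> x))"
    if "\<bar>exp (x \<bullet> x) * a - b\<bar> < e / 2" for a b and x :: 'a
  proof -
    have "a - exp (- (x \<bullet> x)) * b = exp (- (x \<bullet> x)) * (exp (x \<bullet> x) * a - b)"
      by (simp add: right_diff_distrib mult.assoc[symmetric] exp_add[symmetric])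
    then show ?thesis using that by (simp add: abs_mult mult.commute)
  qed
  show thesis
  proof (rule that[OF gaussian_tame_schwartz[OF p(1) q(1)]])
    fix x
    let ?d = "f x - (complex_of_real (exp (- (x \<bullet> x)) * p x) + \<i> * complex_of_real (exp (- (x \<bullet> x)) * q x))"
    have "norm ?d \<le> \<bar>Re ?d\<bar> + \<bar>Im ?d\<bar>" by (rule cmod_le)
    also have "\<dots> = \<bar>Re (f x) - exp (- (x \<bullet> x)) * p x\<bar> + \<bar>Im (f x) - exp (- (x \<bullet> x)) * q x\<bar>"
      by simp
    also have "\<dots> \<le> e * exp (- (x \<bullet> x))"
      using aux[OF p(2)[of x]] aux[OF q(2)[of x]] by (simp add: field_simps)
    finally show "norm ?d \<le> e * exp (- (x \<bullet> x))" .
  qed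
qed

section \<open>Truncation of Schwartz functions to compact support\<close>

lemma schwartz_continuous: "f \<in> schwartz \<Longrightarrow> continuous_on UNIV f"
proof -
  assume "f \<in> schwartz"
  then obtain D where D: "D [] = f" "\<forall>vs x. set vs \<subseteq> Basis \<longrightarrow>
      (\<exists>L. (D vs has_derivative L) (at x) \<and> (\<forall>v\<in>Basis. L v = D (v # vs) x))"
    unfolding schwartz_def by auto
  have "\<exists>L. (f has_derivative L) (at x)" for x
    using D(2)[rule_format, of "[]" x] D(1) by auto
  then show ?thesis
    by (meson continuous_at_imp_continuous_on has_derivative_continuous)
qed

lemma schwartz_decay: "f \<in> schwartz \<Longrightarrow> \<exists>C. \<forall>x. (1 + norm x) ^ N * norm (f x) \<le> C"
proof -
  assume "f \<in> schwartz"
  then obtain D where D: "D [] = f" "\<forall>vs (N::nat). set vs \<subseteq> Basis \<longrightarrow>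
      (\<exists>C. \<forall>x. (1 + norm x) ^ N * norm (D vs x) \<le> C)"
    unfolding schwartz_def by auto
  show ?thesis using D(2)[rule_format, of "[]" N] D(1) by simp
qed

text \<open>One spare power of the weight bounds the tail by \<open>C / (1 + norm x)\<close>, which
  is at most \<open>e\<close> beyond radius \<open>C / e\<close>. A piecewise linear radial cutoff
  suffices, since \<open>Cc\<close> asks only for continuity.\<close>

lemma schwartz_approx_by_Cc:
  fixes g :: "'a::euclidean_space \<Rightarrow> complex"
  assumes "g \<in> schwartz" "e > 0"
  obtains f where "f \<in> Cc" "\<And>x. (1 + norm x) ^ N * norm (g x - f x) \<le> e"
proof -
  obtain C where C: "\<And>x. (1 + norm x) ^ Suc N * norm (g x) \<le> C"
    using schwartz_decay[OF assms(1)] by blast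
  have "C \<ge> 0" using order.trans[OF _ C[of 0]] by simp
  define R where "R = C / e"
  define cut where "cut x = max 0 (min 1 (R + 1 - norm x))" for x :: 'a
  have "(\<lambda>x. of_real (cut x) * g x) \<in> Cc"
    unfolding Cc_def
  proof (intro CollectI conjI exI[of _ "cball 0 (R + 1)"] allI impI)
    show "continuous_on UNIV (\<lambda>x. of_real (cut x) * g x)"
      unfolding cut_def by (intro continuous_intros schwartz_continuous assms)
  qed (auto simp: cut_def)
  then show thesis
  proof (rule that)
    fix x
    have eq: "norm (g x - of_real (cut x) * g x) = (1 - cut x) * norm (g x)"
    proof -
      have "g x - of_real (cut x) * g x = of_real (1 - cut x) * g x" by (simp add: left_diff_distrib)
      then have "norm (g x - of_real (cut x) * g x) = \<bar>1 - cut x\<bar> * norm (g x)"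
        by (simp only: norm_mult norm_of_real)
      then show ?thesis by (simp add: cut_def)
    qed
    show "(1 + norm x) ^ N * norm (g x - of_real (cut x) * g x) \<le> e"
    proof (cases "norm x \<le> R")
      case True
      then show ?thesis using \<open>e > 0\<close> by (simp add: eq cut_def)
    next
      case False
      have "(1 + norm x) ^ N * norm (g x - of_real (cut x) * g x) \<le> (1 + norm x) ^ N * norm (g x)"
        unfolding eq by (intro mult_left_mono) (auto simp: cut_def mult_left_le_one_le)
      also have "\<dots> \<le> C / (1 + norm x)"
        using C[of x] by (simp add: field_simps add_pos_nonneg)
      also have "\<dots> \<le> e"
        using False \<open>e > 0\<close> by (simp add: R_def field_simps add_pos_nonneg)
      finally show ?thesis .
    qed
  qed
qed

section \<open>Comparing the two test function classes\<close>

lemma conv_diff: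
  assumes "integrable \<nu> (\<lambda>s. f (t - s) * h s)" "integrable \<nu> (\<lambda>s. g (t - s) * h s)"
  shows "conv \<nu> h f t - conv \<nu> h g t = conv \<nu> h (\<lambda>x. f x - g x) t"
  unfolding conv_def using assms by (simp add: left_diff_distrib)

text \<open>The weighted bound on \<open>f\<close> passes to \<open>g\<close> with constant
  \<open>A + e\<close>. Both convolutions are then integrals of integrable functions, so their
  difference is the convolution with \<open>f - g\<close>.\<close>

lemma conv_uniformly_close:
  fixes \<nu> :: "'a::euclidean_space measure"
  assumes tb: "translation_bounded_measure \<nu> h"
  shows "\<exists>N C. C \<ge> 0 \<and> (\<forall>(f :: 'a \<Rightarrow> complex) g e. continuous_on UNIV f \<longrightarrow> continuous_on UNIV g \<longrightarrow>
    (\<exists>A. \<forall>x. (1 + norm x) ^ N * norm (f x) \<le> A) \<longrightarrow>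
    (\<forall>x. (1 + norm x) ^ N * norm (f x - g x) \<le> e) \<longrightarrow>
    (\<forall>t. norm (conv \<nu> h f t - conv \<nu> h g t) \<le> C * e))"
proof -
  obtain N :: nat and C :: real where C: "C \<ge> 0" and bd:
    "\<And>(g :: 'a \<Rightarrow> complex) e t. g \<in> borel_measurable borel \<Longrightarrow> (\<forall>x. (1 + norm x) ^ N * norm (g x) \<le> e) \<Longrightarrow>
       integrable \<nu> (\<lambda>s. g (t - s) * h s) \<and> norm (conv \<nu> h g t) \<le> C * e"
    using conv_weight_bound[OF tb] by metis
  have "norm (conv \<nu> h f t - conv \<nu> h g t) \<le> C * e"
    if cont: "continuous_on UNIV f" "continuous_on UNIV g"
      and A: "\<exists>A. \<forall>x. (1 + norm x) ^ N * norm (f x) \<le> A"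
      and e: "\<forall>x. (1 + norm x) ^ N * norm (f x - g x) \<le> e" for f g :: "'a \<Rightarrow> complex" and e t
  proof -
    have m: "f \<in> borel_measurable borel" "g \<in> borel_measurable borel" "(\<lambda>x. f x - g x) \<in> borel_measurable borel"
      using cont by (auto intro!: borel_measurable_continuous_onI continuous_intros)
    obtain A where A: "\<forall>x. (1 + norm x) ^ N * norm (f x) \<le> A" using A by blast
    have B: "\<forall>x. (1 + norm x) ^ N * norm (g x) \<le> A + e"
    proof
      fix x
      have "norm (g x) \<le> norm (f x) + norm (f x - g x)"
        by (metis norm_minus_commute norm_triangle_sub)
      then have "(1 + norm x) ^ N * norm (g x) \<le> (1 + norm x) ^ N * (norm (f x) + norm (f x - g x))"
        by (rule mult_left_mono) simp
      then show "(1 + norm x) ^ N * norm (g x) \<le> A + e"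
        using add_mono[OF A[rule_format, of x] e[rule_format, of x]] by (simp only: distrib_left)
    qed
    then have "conv \<nu> h f t - conv \<nu> h g t = conv \<nu> h (\<lambda>x. f x - g x) t"
      using bd[OF m(1) A] bd[OF m(2) B] by (intro conv_diff) blast+
    then show ?thesis using bd[OF m(3) e] by simp
  qed
  with C show ?thesis by blast
qed

lemma Cc_weight_bounded:
  assumes "f \<in> Cc"
  shows "\<exists>A. \<forall>x. (1 + norm x) ^ N * norm (f x) \<le> A"
proof -
  obtain K where f: "continuous_on UNIV f" "compact K" "\<And>x. x \<notin> K \<Longrightarrow> f x = 0"
    using assms by (auto simp: Cc_def)
  have "continuous_on K (\<lambda>x. (1 + norm x) ^ N * norm (f x))"
    by (intro continuous_intros continuous_on_subset[OF f(1)]) simp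
  then have "bounded ((\<lambda>x. (1 + norm x) ^ N * norm (f x)) ` K)"
    using compact_continuous_image compact_imp_bounded f(2) by blast
  then obtain A where A: "\<And>x. x \<in> K \<Longrightarrow> (1 + norm x) ^ N * norm (f x) \<le> A"
    by (force simp: bounded_iff)
  have "(1 + norm x) ^ N * norm (f x) \<le> max 0 A" for x
    using A[of x] f(3)[of x] by (cases "x \<in> K") auto
  then show ?thesis by blast
qed

text \<open>\<open>W\<close> enters only through closedness under uniform limits, so one argument,
  symmetric in the two test classes, settles all three equivalences.\<close>

lemma schwartz_iff_Cc:
  fixes \<nu> :: "'a::euclidean_space measure"
  assumes tb: "translation_bounded_measure \<nu> h"
    and closed: "\<And>u :: 'a \<Rightarrow> complex. (\<And>e. e > 0 \<Longrightarrow> \<exists>v\<in>W. \<forall>x. norm (u x - v x) \<le> e) \<Longrightarrow> u \<in> W"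
  shows "(\<forall>f\<in>schwartz. conv \<nu> h f \<in> W) \<longleftrightarrow> (\<forall>f\<in>Cc. conv \<nu> h f \<in> W)"
proof -
  obtain N :: nat and C :: real where C: "C \<ge> 0" and close:
    "\<And>f g :: 'a \<Rightarrow> complex. \<And>e t. continuous_on UNIV f \<Longrightarrow> continuous_on UNIV g \<Longrightarrow>
       \<exists>A. \<forall>x. (1 + norm x) ^ N * norm (f x) \<le> A \<Longrightarrow>
       \<forall>x. (1 + norm x) ^ N * norm (f x - g x) \<le> e \<Longrightarrow>
       norm (conv \<nu> h f t - conv \<nu> h g t) \<le> C * e"
    using conv_uniformly_close[OF tb] by metis
  have dense: "conv \<nu> h f \<in> W"
    if f: "continuous_on UNIV f" "\<exists>A. \<forall>x. (1 + norm x) ^ N * norm (f x) \<le> A"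
      and G: "\<And>g. g \<in> G \<Longrightarrow> continuous_on UNIV g" "\<And>g. g \<in> G \<Longrightarrow> conv \<nu> h g \<in> W"
      and approx: "\<And>e. e > 0 \<Longrightarrow> \<exists>g\<in>G. \<forall>x. (1 + norm x) ^ N * norm (f x - g x) \<le> e"
    for f :: "'a \<Rightarrow> complex" and G
  proof (rule closed)
    fix e :: real assume "e > 0"
    \<comment> \<open>Dividing by \<open>C + 1\<close> rather than \<open>C\<close> allows for
      \<open>C = 0\<close>.\<close>
    then have "e / (C + 1) > 0" using C by simp
    from approx[OF this] obtain g where g: "g \<in> G" "\<forall>x. (1 + norm x) ^ N * norm (f x - g x) \<le> e / (C + 1)"
      by blast
    have "norm (conv \<nu> h f t - conv \<nu> h g t) \<le> e" for t
    proof -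
      have "norm (conv \<nu> h f t - conv \<nu> h g t) \<le> C * (e / (C + 1))"
        by (rule close[OF f(1) G(1)[OF g(1)] f(2) g(2)])
      also have "\<dots> \<le> e" using C \<open>e > 0\<close> by (simp add: field_simps)
      finally show ?thesis .
    qed
    then show "\<exists>v\<in>W. \<forall>t. norm (conv \<nu> h f t - v t) \<le> e" using G(2)[OF g(1)] by blast
  qed
  show ?thesis
  proof (intro iffI ballI)
    fix f :: "'a \<Rightarrow> complex"
    assume hyp: "\<forall>f\<in>schwartz. conv \<nu> h f \<in> W" and f: "f \<in> Cc"
    show "conv \<nu> h f \<in> W"
    proof (rule dense[of f schwartz])
      show "continuous_on UNIV f" using f by (simp add: Cc_def)
      fix e :: real assume "e > 0"
      \<comment> \<open>The divisor is the bound on the weight times the Gaussian, so the weighted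
        error comes out as exactly \<open>e\<close>.\<close>
      then have "e / exp ((real N)\<^sup>2) > 0" by simp
      from Cc_approx_by_schwartz[OF f this] obtain g where g: "g \<in> schwartz"
        "\<And>x. norm (f x - g x) \<le> e / exp ((real N)\<^sup>2) * exp (- (x \<bullet> x))" by blast
      have "(1 + norm x) ^ N * norm (f x - g x) \<le> e" for x
      proof -
        have "(1 + norm x) ^ N * norm (f x - g x) \<le> (1 + norm x) ^ N * (e / exp ((real N)\<^sup>2) * exp (- (x \<bullet> x)))"
          by (intro mult_left_mono g(2)) simp
        also have "\<dots> = e / exp ((real N)\<^sup>2) * ((1 + norm x) ^ N * exp (- (x \<bullet> x)))" by simp
        also have "\<dots> \<le> e / exp ((real N)\<^sup>2) * exp ((real N)\<^sup>2)"
          using \<open>e > 0\<close> by (intro mult_left_mono weight_gaussian_bounded) simp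
        finally show ?thesis by simp
      qed
      with g(1) show "\<exists>g\<in>schwartz. \<forall>x. (1 + norm x) ^ N * norm (f x - g x) \<le> e" by blast
    qed (use hyp schwartz_continuous Cc_weight_bounded[OF f] in auto)
  next
    fix f :: "'a \<Rightarrow> complex"
    assume hyp: "\<forall>f\<in>Cc. conv \<nu> h f \<in> W" and f: "f \<in> schwartz"
    show "conv \<nu> h f \<in> W"
    proof (rule dense[of f Cc])
      fix e :: real assume "e > 0"
      from schwartz_approx_by_Cc[OF f this]
      show "\<exists>g\<in>Cc. \<forall>x. (1 + norm x) ^ N * norm (f x - g x) \<le> e" by metis
    qed (use hyp schwartz_continuous[OF f] schwartz_decay[OF f] in \<open>auto simp: Cc_def\<close>)
  qed
qed

theorem theorem5p12:
  fixes \<nu> :: "'a::euclidean_space measure" and h :: "'a \<Rightarrow> complex"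
  assumes "translation_bounded_measure \<nu> h"
  shows "((\<forall>f\<in>schwartz. conv \<nu> h f \<in> WAP) \<longleftrightarrow> (\<forall>f\<in>Cc. conv \<nu> h f \<in> WAP))
       \<and> ((\<forall>f\<in>schwartz. conv \<nu> h f \<in> SAP) \<longleftrightarrow> (\<forall>f\<in>Cc. conv \<nu> h f \<in> SAP))
       \<and> ((\<forall>f\<in>schwartz. conv \<nu> h f \<in> WAP0) \<longleftrightarrow> (\<forall>f\<in>Cc. conv \<nu> h f \<in> WAP0))"
  using schwartz_iff_Cc[OF assms WAP_uniform_approx] schwartz_iff_Cc[OF assms SAP_uniform_approx]
    schwartz_iff_Cc[OF assms WAP0_uniform_approx] by blast

end
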